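(* Let $\mathcal{A},\mathcal{B}\in\mathbb{C}^{\mathbf{N}(n)\times\mathbf{N}(n)}$ be core tensors. Assume that $\mathscr{R}(\mathcal{A})\subseteq\mathscr{R}(\mathcal{A}*_n\mathcal{B})$ and that $\mathcal{A}$ is EP. If $(\mathcal{A}*_n\mathcal{B})^{\mathrm{core}}=\mathcal{B}^{\mathrm{core}}*_n\mathcal{A}^{\mathrm{core}}$, then $\bigl((\mathcal{A}^{\mathrm{core}})^**_n\mathcal{B}\bigr)^{\mathrm{core}}=\mathcal{B}^{\mathrm{core}}*_n\mathcal{A}^*$.
   Context: Here $\mathbf{N}(n)=N_1\times\cdots\times N_n$ and $\mathbb{C}^{\mathbf{N}(n)\times\mathbf{N}(n)}$ is the set of complex tensors $\mathcal{A}=(a_{i_1\ldots i_n j_1\ldots j_n})$ with $1\le i_k,j_k\le N_k$. The Einstein product is $(\mathcal{A}*_n\mathcal{B})_{i_1\ldots i_n j_1\ldots j_n}=\sum_{k_1,\ldots,k_n}a_{i_1\ldots i_n k_1\ldots k_n}b_{k_1\ldots k_n j_1\ldots j_n}$ (and similarly $\mathcal{A}*_n\mathcal{X}\in\mathbb{C}^{\mathbf{N}(n)}$ for $\mathcal{X}\in\mathbb{C}^{\mathbf{N}(n)}$), powers are taken with respect to $*_n$, and $\mathcal{A}^*$ is the conjugate transpose (swap the first $n$ and last $n$ indices and conjugate). The range is $\mathscr{R}(\mathcal{A})=\{\mathcal{A}*_n\mathcal{X}:\mathcal{X}\in\mathbb{C}^{\mathbf{N}(n)}\}$. The index $\mathrm{ind}(\mathcal{A})$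 is the smallest positive integer $k$ with $\mathscr{R}(\mathcal{A}^k)=\mathscr{R}(\mathcal{A}^{k+1})$; $\mathcal{A}$ is a core tensor if $\mathrm{ind}(\mathcal{A})=1$. The core inverse $\mathcal{A}^{\mathrm{core}}$ is the tensor $\mathcal{X}$ (unique when it exists; it exists when $\mathcal{A}$ is a core tensor) with $(\mathcal{A}*_n\mathcal{X})^*=\mathcal{A}*_n\mathcal{X}$, $\mathcal{X}*_n\mathcal{A}^2=\mathcal{A}$, $\mathcal{A}*_n\mathcal{X}^2=\mathcal{X}$. An equality involving a core inverse is understood to include its existence. The Moore-Penrose inverse $\mathcal{A}^\dagger$ is the unique $\mathcal{X}$ with $\mathcal{A}*_n\mathcal{X}*_n\mathcal{A}=\mathcal{A}$, $\mathcal{X}*_n\mathcal{A}*_n\mathcal{X}=\mathcal{X}$, and $\mathcal{A}*_n\mathcal{X}$, $\mathcal{X}*_n\mathcal{A}$ both Hermitian; $\mathcal{A}$ is EP if $\mathcal{A}*_n\mathcal{A}^\dagger=\mathcal{A}^\dagger*_n\mathcal{A}$. *)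

theory Defs
  imports Complex_Main "HOL-Library.FuncSet"
begin

text \<open>
  A dimension list \<open>D = [D\<^sub>1, \<dots>, D\<^sub>m]\<close> stands for \<open>D\<^sub>1 \<times> \<dots> \<times> D\<^sub>m\<close>. A tensor of order \<open>m\<close> assigns an
  entry to each multi-index \<open>[i\<^sub>1, \<dots>, i\<^sub>m]\<close> with \<open>1 \<le> i\<^sub>k \<le> D\<^sub>k\<close> and is \<open>undefined\<close> on other lists, so
  that HOL equality of tensors of equal dimensions is entrywise equality. The space
  \<open>\<complex>\<^bsup>\<^bold>N(n)\<times>\<^bold>N(n)\<^esup>\<close> is \<open>tensors (N @ N)\<close> with \<open>n = length N\<close>, and the entry
  \<open>a\<close> with indices \<open>i\<^sub>1 \<dots> i\<^sub>n j\<^sub>1 \<dots> j\<^sub>n\<close> is \<open>A (i @ j)\<close>.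
\<close>

type_synonym tensor = "nat list \<Rightarrow> complex"

definition multi_indices :: "nat list \<Rightarrow> nat list set" where
  "multi_indices D = {i. list_all2 (\<lambda>i\<^sub>k D\<^sub>k. 1 \<le> i\<^sub>k \<and> i\<^sub>k \<le> D\<^sub>k) i D}"

lemma finite_multi_indices: "finite (multi_indices D)"
proof (induction D)
  case Nil
  then show ?case by (simp add: multi_indices_def)
next
  case (Cons d D)
  have "multi_indices (d # D) \<subseteq> (\<lambda>(x, xs). x # xs) ` ({1..d} \<times> multi_indices D)"
    by (auto simp: multi_indices_def list_all2_Cons2 image_iff)
  then show ?case
    by (rule finite_subset) (use Cons.IH in auto)
qed

definition tensors :: "nat list \<Rightarrow> tensor set" where
  "tensors D = multi_indices D \<rightarrow>\<^sub>E UNIV"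

text \<open>
  Contraction of a tensor of dimensions \<open>I @ K\<close> with one of dimensions \<open>K @ J\<close> over the shared
  indices. Taking \<open>I = K = N\<close>, the product on \<open>tensors (N @ N)\<close> is the case \<open>J = N\<close>, and the
  action on \<open>tensors N\<close> is the case \<open>J = []\<close>.
\<close>

definition contraction ::
  "nat list \<Rightarrow> nat list \<Rightarrow> nat list \<Rightarrow> tensor \<Rightarrow> tensor \<Rightarrow> tensor" where
  "contraction I K J A B = (\<lambda>p\<in>multi_indices (I @ J).
     \<Sum>k\<in>multi_indices K. A (take (length I) p @ k) * B (k @ drop (length I) p))"

definition einstein_product :: "tensor \<Rightarrow> nat list \<Rightarrow> tensor \<Rightarrow> tensor"
    ("(_ \<star>\<^bsub>_\<^esub>/ _)" [70, 0, 71] 70) where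
  "A \<star>\<^bsub>N\<^esub> B = contraction N N N A B"

definition identity_tensor :: "nat list \<Rightarrow> tensor" where
  "identity_tensor N = (\<lambda>p\<in>multi_indices (N @ N).
     if take (length N) p = drop (length N) p then 1 else 0)"

primrec tensor_power :: "nat list \<Rightarrow> tensor \<Rightarrow> nat \<Rightarrow> tensor" where
  "tensor_power N A 0 = identity_tensor N"
| "tensor_power N A (Suc m) = tensor_power N A m \<star>\<^bsub>N\<^esub> A"

definition conj_transpose :: "nat list \<Rightarrow> tensor \<Rightarrow> tensor" where
  "conj_transpose N A = (\<lambda>p\<in>multi_indices (N @ N).
     cnj (A (drop (length N) p @ take (length N) p)))"

definition tensor_range :: "nat list \<Rightarrow> tensor \<Rightarrow> tensor set" where
  "tensor_range N A = {contraction N N [] A X |X. X \<in> tensors N}"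

definition tensor_index :: "nat list \<Rightarrow> tensor \<Rightarrow> nat" where
  "tensor_index N A = (LEAST k. 0 < k \<and>
     tensor_range N (tensor_power N A k) = tensor_range N (tensor_power N A (k + 1)))"

definition core_tensor :: "nat list \<Rightarrow> tensor \<Rightarrow> bool" where
  "core_tensor N A \<longleftrightarrow> A \<in> tensors (N @ N) \<and> tensor_index N A = 1"

definition is_core_inverse :: "nat list \<Rightarrow> tensor \<Rightarrow> tensor \<Rightarrow> bool" where
  "is_core_inverse N A X \<longleftrightarrow> X \<in> tensors (N @ N) \<and>
     conj_transpose N (A \<star>\<^bsub>N\<^esub> X) = A \<star>\<^bsub>N\<^esub> X \<and>
     X \<star>\<^bsub>N\<^esub> tensor_power N A 2 = A \<and>
     A \<star>\<^bsub>N\<^esub> tensor_power N X 2 = X"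

definition core_invertible :: "nat list \<Rightarrow> tensor \<Rightarrow> bool" where
  "core_invertible N A \<longleftrightarrow> (\<exists>X. is_core_inverse N A X)"

text \<open>
  \<open>core_inverse N A\<close> is meaningful only under \<open>core_invertible N A\<close>, which holds when \<open>A\<close> is a
  core tensor; for other tensors existence has to be stated separately.
\<close>

definition core_inverse :: "nat list \<Rightarrow> tensor \<Rightarrow> tensor" where
  "core_inverse N A = (THE X. is_core_inverse N A X)"

definition is_moore_penrose_inverse :: "nat list \<Rightarrow> tensor \<Rightarrow> tensor \<Rightarrow> bool" where
  "is_moore_penrose_inverse N A X \<longleftrightarrow> X \<in> tensors (N @ N) \<and>
     A \<star>\<^bsub>N\<^esub> X \<star>\<^bsub>N\<^esub> A = A \<and>
     X \<star>\<^bsub>N\<^esub> A \<star>\<^bsub>N\<^esub> X = X \<and>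
     conj_transpose N (A \<star>\<^bsub>N\<^esub> X) = A \<star>\<^bsub>N\<^esub> X \<and>
     conj_transpose N (X \<star>\<^bsub>N\<^esub> A) = X \<star>\<^bsub>N\<^esub> A"

definition moore_penrose_inverse :: "nat list \<Rightarrow> tensor \<Rightarrow> tensor" where
  "moore_penrose_inverse N A = (THE X. is_moore_penrose_inverse N A X)"

definition EP_tensor :: "nat list \<Rightarrow> tensor \<Rightarrow> bool" where
  "EP_tensor N A \<longleftrightarrow>
     A \<star>\<^bsub>N\<^esub> moore_penrose_inverse N A = moore_penrose_inverse N A \<star>\<^bsub>N\<^esub> A"

end

theory Submission
  imports Defs
begin

text \<open>
  Write \<open>X\<close>, \<open>Y\<close> for the core inverses of \<open>A\<close>, \<open>B\<close>, juxtaposition for the Einstein product and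
  \<open>\<^sup>*\<close> for the conjugate transpose. Since \<open>A\<close> is EP, its Moore-Penrose inverse satisfies the
  equations of the core inverse, so that \<open>X\<close> commutes with \<open>A\<close> and \<open>P = A X = X A\<close> is the orthogonal
  projection onto the range of \<open>A\<close>. It fixes \<open>A\<^sup>*\<close> and \<open>X\<^sup>*\<close> on the left, and \<open>A\<^sup>* X\<^sup>* = P\<close>. The range
  inclusion says that \<open>A B\<close> has the same range as \<open>A\<close>; hence \<open>(A B) (Y X)\<close>, the orthogonal
  projection onto that range, is \<open>P\<close>. The two other equations for the core inverse \<open>Y X\<close> of \<open>A B\<close> give
  \<open>P Y P = Y P\<close> and \<open>Y P B P = P\<close>. Put \<open>C = X\<^sup>* B\<close> and \<open>W = Y A\<^sup>*\<close>. As \<open>B Y\<close> is Hermitian,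
  \<open>C W = X\<^sup>* (B Y) A\<^sup>* = (A B Y X)\<^sup>* = P\<close>; then \<open>C W W = P Y P A\<^sup>* = W\<close> and
  \<open>W C C = Y P B P X\<^sup>* B = C\<close>, so \<open>W\<close> is the core inverse of \<open>C\<close>.

  The existence of core and Moore-Penrose inverses rests on orthogonal projections. Gram-Schmidt
  orthogonalisation of the columns of \<open>A\<close> yields \<open>H\<close> such that \<open>A H\<close> is Hermitian and
  \<open>A H A = A\<close>, with a natural number as trace of \<open>A H\<close> (\<open>ex_hermitian_inner_inverse\<close>). Such tensors for \<open>A\<close>
  and \<open>A\<^sup>*\<close> combine to a Moore-Penrose inverse. Finite dimensionality enters through the trace:
  for nested orthogonal projections the difference of the traces is the squared Frobenius norm of the
  difference (\<open>trace_projection_diff\<close>). This makes the chain of ranges of the powers of \<open>A\<close>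
  stabilise, so that the index is attained, and it turns the right inverse of \<open>A\<close> on the range of a
  core tensor into a two-sided one (\<open>core_tensor_core_invertible\<close>).
\<close>

section \<open>Tensors as matrices over multi-indices\<close>

lemma length_multi_index: "i \<in> multi_indices D \<Longrightarrow> length i = length D"
  by (auto simp: multi_indices_def dest: list_all2_lengthD)

lemma append_in_multi_indices:
  assumes "length i = length I"
  shows "i @ j \<in> multi_indices (I @ J) \<longleftrightarrow> i \<in> multi_indices I \<and> j \<in> multi_indices J"
  using assms by (simp add: multi_indices_def list_all2_append)

lemma multi_index_appendE:
  assumes "p \<in> multi_indices (I @ J)"
  obtains i j where "p = i @ j" "i \<in> multi_indices I" "j \<in> multi_indices J"
  using assms by (auto simp: multi_indices_def list_all2_append2)

lemma multi_indices_Nil: "multi_indices [] = {[]}"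
  by (auto simp: multi_indices_def)

lemma tensor_eqI:
  assumes "A \<in> tensors (I @ J)" "B \<in> tensors (I @ J)"
    and "\<And>i j. i \<in> multi_indices I \<Longrightarrow> j \<in> multi_indices J \<Longrightarrow> A (i @ j) = B (i @ j)"
  shows "A = B"
  using assms(1,2) unfolding tensors_def
  by (rule PiE_ext) (metis assms(3) multi_index_appendE)

lemma contraction_in_tensors: "contraction I K J A B \<in> tensors (I @ J)"
  by (simp add: contraction_def tensors_def)

lemma contraction_entry:
  assumes "i \<in> multi_indices I" "j \<in> multi_indices J"
  shows "contraction I K J A B (i @ j) = (\<Sum>k\<in>multi_indices K. A (i @ k) * B (k @ j))"
  using assms length_multi_index[OF assms(1)]
  by (simp add: contraction_def append_in_multi_indices)

lemma contraction_assoc: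
  "contraction I L J (contraction I K L A B) C = contraction I K J A (contraction K L J B C)"
proof (rule tensor_eqI[OF contraction_in_tensors contraction_in_tensors])
  fix i j assume ij: "i \<in> multi_indices I" "j \<in> multi_indices J"
  have "contraction I L J (contraction I K L A B) C (i @ j)
      = (\<Sum>l\<in>multi_indices L. \<Sum>k\<in>multi_indices K. A (i @ k) * B (k @ l) * C (l @ j))"
    using ij by (simp add: contraction_entry sum_distrib_right)
  also have "\<dots> = (\<Sum>k\<in>multi_indices K. \<Sum>l\<in>multi_indices L. A (i @ k) * B (k @ l) * C (l @ j))"
    by (rule sum.swap)
  also have "\<dots> = contraction I K J A (contraction K L J B C) (i @ j)"
    using ij by (simp add: contraction_entry sum_distrib_left mult.assoc)
  finally show "contraction I L J (contraction I K L A B) C (i @ j)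
      = contraction I K J A (contraction K L J B C) (i @ j)" .
qed

lemma einstein_product_in_tensors [simp]: "A \<star>\<^bsub>N\<^esub> B \<in> tensors (N @ N)"
  by (simp add: einstein_product_def contraction_in_tensors)

lemma einstein_product_entry:
  assumes "i \<in> multi_indices N" "j \<in> multi_indices N"
  shows "(A \<star>\<^bsub>N\<^esub> B) (i @ j) = (\<Sum>k\<in>multi_indices N. A (i @ k) * B (k @ j))"
  using assms by (simp add: einstein_product_def contraction_entry)

lemma einstein_product_assoc: "A \<star>\<^bsub>N\<^esub> B \<star>\<^bsub>N\<^esub> C = A \<star>\<^bsub>N\<^esub> (B \<star>\<^bsub>N\<^esub> C)"
  by (simp add: einstein_product_def contraction_assoc)

lemma einstein_product_extend:
  assumes "A \<star>\<^bsub>N\<^esub> B = C"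
  shows "A \<star>\<^bsub>N\<^esub> (B \<star>\<^bsub>N\<^esub> D) = C \<star>\<^bsub>N\<^esub> D"
  using assms by (simp flip: einstein_product_assoc)

lemma identity_tensor_entry:
  assumes "i \<in> multi_indices N" "j \<in> multi_indices N"
  shows "identity_tensor N (i @ j) = (if i = j then 1 else 0)"
  using assms length_multi_index[OF assms(1)]
  by (simp add: identity_tensor_def append_in_multi_indices)

lemma identity_tensor_left:
  assumes "A \<in> tensors (N @ N)"
  shows "identity_tensor N \<star>\<^bsub>N\<^esub> A = A"
  by (rule tensor_eqI[OF einstein_product_in_tensors assms])
    (simp add: einstein_product_entry identity_tensor_entry if_distrib[of "\<lambda>x. x * _"]
      finite_multi_indices sum.delta cong: if_cong)

lemma tensor_power_2:
  assumes "A \<in> tensors (N @ N)"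
  shows "tensor_power N A 2 = A \<star>\<^bsub>N\<^esub> A"
  using assms by (simp add: numeral_2_eq_2 identity_tensor_left)

lemma conj_transpose_in_tensors [simp]: "conj_transpose N A \<in> tensors (N @ N)"
  by (simp add: conj_transpose_def tensors_def)

lemma conj_transpose_entry:
  assumes "i \<in> multi_indices N" "j \<in> multi_indices N"
  shows "conj_transpose N A (i @ j) = cnj (A (j @ i))"
  using assms length_multi_index[OF assms(1)]
  by (simp add: conj_transpose_def append_in_multi_indices)

lemma conj_transpose_product:
  "conj_transpose N (A \<star>\<^bsub>N\<^esub> B) = conj_transpose N B \<star>\<^bsub>N\<^esub> conj_transpose N A"
  by (rule tensor_eqI[OF conj_transpose_in_tensors einstein_product_in_tensors])
    (simp add: conj_transpose_entry einstein_product_entry mult.commute)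

lemma conj_transpose_conj_transpose:
  assumes "A \<in> tensors (N @ N)"
  shows "conj_transpose N (conj_transpose N A) = A"
  by (rule tensor_eqI[OF conj_transpose_in_tensors assms]) (simp add: conj_transpose_entry)

text \<open>
  Inclusion of ranges is right divisibility: the columns of \<open>T\<close> are preimages under \<open>C\<close> of the
  images under \<open>A\<close> of the unit tensors \<open>e j\<close>.
\<close>

lemma tensor_range_subset_iff:
  assumes "A \<in> tensors (N @ N)"
  shows "tensor_range N A \<subseteq> tensor_range N C \<longleftrightarrow> (\<exists>T\<in>tensors (N @ N). A = C \<star>\<^bsub>N\<^esub> T)"
proof
  assume sub: "tensor_range N A \<subseteq> tensor_range N C"
  define e :: "nat list \<Rightarrow> tensor" where
    "e j = (\<lambda>i\<in>multi_indices N. if i = j then 1 else 0)" for j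
  have "\<exists>x. contraction N N [] A (e j) = contraction N N [] C x" for j
  proof -
    have "e j \<in> tensors N"
      by (simp add: e_def tensors_def)
    then show ?thesis
      using sub unfolding tensor_range_def by blast
  qed
  then obtain t where t: "\<And>j. contraction N N [] A (e j) = contraction N N [] C (t j)"
    by metis
  define T :: tensor where
    "T = (\<lambda>p\<in>multi_indices (N @ N). t (drop (length N) p) (take (length N) p))"
  have T_entry: "T (i @ j) = t j i" if "i \<in> multi_indices N" "j \<in> multi_indices N" for i j
    using that length_multi_index[OF that(1)] by (simp add: T_def append_in_multi_indices)
  have "A = C \<star>\<^bsub>N\<^esub> T"
  proof (rule tensor_eqI[OF assms einstein_product_in_tensors])
    fix i j assume ij: "i \<in> multi_indices N" "j \<in> multi_indices N"
    have "A (i @ j) = contraction N N [] A (e j) (i @ [])"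
      using ij by (subst contraction_entry)
        (simp_all add: multi_indices_Nil e_def if_distrib[of "\<lambda>x. _ * x"] finite_multi_indices
          sum.delta cong: if_cong)
    also have "\<dots> = contraction N N [] C (t j) (i @ [])"
      by (simp only: t)
    also have "\<dots> = (C \<star>\<^bsub>N\<^esub> T) (i @ j)"
      using ij by (subst contraction_entry) (simp_all add: multi_indices_Nil einstein_product_entry T_entry)
    finally show "A (i @ j) = (C \<star>\<^bsub>N\<^esub> T) (i @ j)" .
  qed
  moreover have "T \<in> tensors (N @ N)"
    by (simp add: T_def tensors_def)
  ultimately show "\<exists>T\<in>tensors (N @ N). A = C \<star>\<^bsub>N\<^esub> T"
    by blast
next
  assume "\<exists>T\<in>tensors (N @ N). A = C \<star>\<^bsub>N\<^esub> T"
  then obtain T where T: "A = C \<star>\<^bsub>N\<^esub> T" by blast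
  have "contraction N N [] T x \<in> tensors N" for x
    using contraction_in_tensors[of N N "[]"] by simp
  then show "tensor_range N A \<subseteq> tensor_range N C"
    unfolding T tensor_range_def einstein_product_def contraction_assoc by blast
qed

section \<open>Orthogonal projections onto column spaces\<close>

text \<open>
  The matrix \<open>p i j = (\<Sum>s\<in>S. a i s * h s j)\<close> is the orthogonal projection onto the span of the
  columns of \<open>a\<close> that are indexed by \<open>S\<close>: it is Hermitian, fixes these columns, and factors through
  them. Adding a column with residual \<open>r\<close> adds the rank-one projection \<open>r r\<^sup>* / (r\<^sup>* r)\<close> and raises
  the trace by \<open>1\<close>, or changes nothing when \<open>r = 0\<close>; the convention \<open>x / 0 = 0\<close> lets one formula
  cover both cases.
\<close>

lemma gram_schmidt_projection:
  fixes a :: "'a \<Rightarrow> 'b \<Rightarrow> complex"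
  assumes I: "finite I" and S: "finite S"
  shows "\<exists>h. (\<forall>i\<in>I. \<forall>j\<in>I. cnj (\<Sum>s\<in>S. a j s * h s i) = (\<Sum>s\<in>S. a i s * h s j)) \<and>
             (\<forall>i\<in>I. \<forall>t\<in>S. (\<Sum>j\<in>I. (\<Sum>s\<in>S. a i s * h s j) * a j t) = a i t) \<and>
             (\<Sum>i\<in>I. \<Sum>s\<in>S. a i s * h s i) \<in> \<nat>"
  using S
proof (induction S rule: finite_induct)
  case empty
  show ?case by simp
next
  case (insert k S)
  then obtain h where
      herm: "\<And>i j. i \<in> I \<Longrightarrow> j \<in> I \<Longrightarrow> cnj (\<Sum>s\<in>S. a j s * h s i) = (\<Sum>s\<in>S. a i s * h s j)"
    and fixes_cols: "\<And>i t. i \<in> I \<Longrightarrow> t \<in> S \<Longrightarrow> (\<Sum>j\<in>I. (\<Sum>s\<in>S. a i s * h s j) * a j t) = a i t"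
    and tr: "(\<Sum>i\<in>I. \<Sum>s\<in>S. a i s * h s i) \<in> \<nat>"
    by blast
  define p where "p i j = (\<Sum>s\<in>S. a i s * h s j)" for i j
  define r where "r i = a i k - (\<Sum>j\<in>I. p i j * a j k)" for i
  define c where "c = (\<Sum>j\<in>I. cnj (r j) * r j)"
  define h' where "h' s j = (if s = k then cnj (r j) / c
      else h s j - (\<Sum>m\<in>I. h s m * a m k) * (cnj (r j) / c))" for s j
  have p': "(\<Sum>s\<in>insert k S. a i s * h' s j) = p i j + r i * (cnj (r j) / c)" for i j
  proof -
    have "(\<Sum>s\<in>S. a i s * (\<Sum>m\<in>I. h s m * a m k)) = (\<Sum>m\<in>I. p i m * a m k)"
      unfolding p_def sum_distrib_left sum_distrib_right mult.assoc by (rule sum.swap)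
    moreover have "(\<Sum>s\<in>S. a i s * h' s j)
        = (\<Sum>s\<in>S. a i s * h s j - a i s * (\<Sum>m\<in>I. h s m * a m k) * (cnj (r j) / c))"
      using insert.hyps by (intro sum.cong) (auto simp: h'_def algebra_simps)
    ultimately have "(\<Sum>s\<in>S. a i s * h' s j) = p i j - (\<Sum>m\<in>I. p i m * a m k) * (cnj (r j) / c)"
      by (simp only: sum_subtractf p_def flip: sum_distrib_right)
    then show ?thesis
      using insert.hyps by (simp add: h'_def r_def algebra_simps diff_divide_distrib)
  qed
  have cnj_r: "cnj (r j) = cnj (a j k) - (\<Sum>m\<in>I. cnj (a m k) * p m j)" if "j \<in> I" for j
  proof -
    have "(\<Sum>m\<in>I. cnj (p j m) * cnj (a m k)) = (\<Sum>m\<in>I. cnj (a m k) * p m j)"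
      using herm that by (intro sum.cong) (auto simp: p_def simp del: cnj_sum)
    then show ?thesis
      by (simp add: r_def)
  qed
  have orth: "(\<Sum>j\<in>I. cnj (r j) * a j t) = 0" if t: "t \<in> S" for t
  proof -
    have "(\<Sum>j\<in>I. (\<Sum>m\<in>I. cnj (a m k) * p m j) * a j t)
        = (\<Sum>m\<in>I. cnj (a m k) * (\<Sum>j\<in>I. p m j * a j t))"
      unfolding sum_distrib_left sum_distrib_right mult.assoc by (rule sum.swap)
    also have "\<dots> = (\<Sum>m\<in>I. cnj (a m k) * a m t)"
      using fixes_cols t by (intro sum.cong) (auto simp: p_def)
    finally show ?thesis
      by (simp add: cnj_r left_diff_distrib sum_subtractf)
  qed
  have orth_p: "(\<Sum>j\<in>I. cnj (r j) * p j m) = 0" for m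
  proof -
    have "(\<Sum>j\<in>I. cnj (r j) * p j m) = (\<Sum>s\<in>S. (\<Sum>j\<in>I. cnj (r j) * a j s) * h s m)"
      unfolding p_def sum_distrib_left sum_distrib_right mult.assoc by (rule sum.swap)
    also have "\<dots> = 0"
      by (simp add: orth)
    finally show ?thesis .
  qed
  have new_col: "(\<Sum>j\<in>I. cnj (r j) * a j k) = c"
  proof -
    have "(\<Sum>j\<in>I. cnj (r j) * (\<Sum>m\<in>I. p j m * a m k))
        = (\<Sum>m\<in>I. (\<Sum>j\<in>I. cnj (r j) * p j m) * a m k)"
      unfolding sum_distrib_left sum_distrib_right mult.assoc by (rule sum.swap)
    also have "\<dots> = 0"
      by (simp add: orth_p)
    finally show ?thesis
      by (simp add: c_def r_def[of j for j] right_diff_distrib sum_subtractf)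
  qed
  have c_real: "c = of_real (\<Sum>j\<in>I. (cmod (r j))\<^sup>2)"
    unfolding c_def of_real_sum complex_norm_square by (simp only: mult.commute)
  \<comment> \<open>For \<open>c = 0\<close> this says that the residual vanishes.\<close>
  have c_div: "r i * (c / c) = r i" if "i \<in> I" for i
  proof (cases "c = 0")
    case True
    then have "(\<Sum>j\<in>I. (cmod (r j))\<^sup>2) = 0"
      using c_real of_real_eq_0_iff by metis
    then have "r i = 0"
      using I that by (simp add: sum_nonneg_eq_0_iff)
    then show ?thesis by simp
  qed simp
  have "cnj (\<Sum>s\<in>insert k S. a j s * h' s i) = (\<Sum>s\<in>insert k S. a i s * h' s j)"
    if "i \<in> I" "j \<in> I" for i j
  proof -
    have "cnj (p j i) = p i j"
      using herm that by (simp add: p_def del: cnj_sum)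
    moreover have "cnj c = c"
      by (simp only: c_real complex_cnj_complex_of_real)
    ultimately show ?thesis
      by (simp add: p' del: cnj_sum)
  qed
  moreover have "(\<Sum>j\<in>I. (\<Sum>s\<in>insert k S. a i s * h' s j) * a j t) = a i t"
    if i: "i \<in> I" and t: "t \<in> insert k S" for i t
  proof -
    have eq: "(\<Sum>j\<in>I. (\<Sum>s\<in>insert k S. a i s * h' s j) * a j t)
        = (\<Sum>j\<in>I. p i j * a j t) + r i * ((\<Sum>j\<in>I. cnj (r j) * a j t) / c)"
      unfolding p'
      by (simp add: distrib_right sum.distrib sum_distrib_left sum_divide_distrib mult.assoc)
    show ?thesis
    proof (cases "t = k")
      case True
      show ?thesis
        unfolding eq unfolding True new_col c_div[OF i] by (simp add: r_def)
    next
      case False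
      then show ?thesis
        using fixes_cols[OF i] t unfolding eq by (simp add: orth p_def)
    qed
  qed
  moreover have "(\<Sum>i\<in>I. \<Sum>s\<in>insert k S. a i s * h' s i) \<in> \<nat>"
  proof -
    have "(\<Sum>i\<in>I. \<Sum>s\<in>insert k S. a i s * h' s i) = (\<Sum>i\<in>I. p i i) + c / c"
      unfolding p' by (simp add: sum.distrib c_def mult.commute flip: sum_divide_distrib)
    moreover have "c / c \<in> \<nat>"
      by (cases "c = 0") auto
    ultimately show ?thesis
      using tr by (simp add: p_def)
  qed
  ultimately show ?case
    by blast
qed

text \<open>The trace of a tensor in \<open>tensors (N @ N)\<close>, read as a square matrix over multi-indices.\<close>

definition tensor_trace :: "nat list \<Rightarrow> tensor \<Rightarrow> complex" where
  "tensor_trace N A = (\<Sum>i\<in>multi_indices N. A (i @ i))"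

lemma tensor_trace_commute: "tensor_trace N (A \<star>\<^bsub>N\<^esub> B) = tensor_trace N (B \<star>\<^bsub>N\<^esub> A)"
proof -
  have "tensor_trace N (A \<star>\<^bsub>N\<^esub> B)
      = (\<Sum>i\<in>multi_indices N. \<Sum>k\<in>multi_indices N. A (i @ k) * B (k @ i))"
    by (simp add: tensor_trace_def einstein_product_entry)
  also have "\<dots> = (\<Sum>k\<in>multi_indices N. \<Sum>i\<in>multi_indices N. A (i @ k) * B (k @ i))"
    by (rule sum.swap)
  finally show ?thesis
    by (simp add: tensor_trace_def einstein_product_entry mult.commute)
qed

text \<open>
  Here \<open>A H\<close> is the orthogonal projection onto the range of \<open>A\<close>, and its trace is the rank of \<open>A\<close>.
\<close>

lemma ex_hermitian_inner_inverse:
  assumes A: "A \<in> tensors (N @ N)"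
  obtains H where "H \<in> tensors (N @ N)" "conj_transpose N (A \<star>\<^bsub>N\<^esub> H) = A \<star>\<^bsub>N\<^esub> H"
    "A \<star>\<^bsub>N\<^esub> (H \<star>\<^bsub>N\<^esub> A) = A" "tensor_trace N (A \<star>\<^bsub>N\<^esub> H) \<in> \<nat>"
proof -
  let ?I = "multi_indices N"
  obtain h where
      herm: "\<forall>i\<in>?I. \<forall>j\<in>?I. cnj (\<Sum>s\<in>?I. A (j @ s) * h s i) = (\<Sum>s\<in>?I. A (i @ s) * h s j)"
    and fixes_cols: "\<forall>i\<in>?I. \<forall>t\<in>?I. (\<Sum>j\<in>?I. (\<Sum>s\<in>?I. A (i @ s) * h s j) * A (j @ t)) = A (i @ t)"
    and tr: "(\<Sum>i\<in>?I. \<Sum>s\<in>?I. A (i @ s) * h s i) \<in> \<nat>"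
    using gram_schmidt_projection[of ?I ?I "\<lambda>i s. A (i @ s)"] finite_multi_indices by blast
  define H :: tensor where
    "H = (\<lambda>p\<in>multi_indices (N @ N). h (take (length N) p) (drop (length N) p))"
  have AH: "(A \<star>\<^bsub>N\<^esub> H) (i @ j) = (\<Sum>s\<in>?I. A (i @ s) * h s j)" if "i \<in> ?I" "j \<in> ?I" for i j
    using that
    by (simp add: einstein_product_entry H_def append_in_multi_indices length_multi_index)
  show ?thesis
  proof
    show "H \<in> tensors (N @ N)"
      by (simp add: H_def tensors_def)
    show "conj_transpose N (A \<star>\<^bsub>N\<^esub> H) = A \<star>\<^bsub>N\<^esub> H"
      by (rule tensor_eqI[of _ N N]) (use herm in \<open>auto simp: conj_transpose_entry AH simp del: cnj_sum\<close>)
    show "A \<star>\<^bsub>N\<^esub> (H \<star>\<^bsub>N\<^esub> A) = A"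
      unfolding einstein_product_assoc[symmetric]
      by (rule tensor_eqI[OF einstein_product_in_tensors A])
        (use fixes_cols in \<open>simp add: einstein_product_entry[of _ _ _ "A \<star>\<^bsub>N\<^esub> H"] AH\<close>)
    show "tensor_trace N (A \<star>\<^bsub>N\<^esub> H) \<in> \<nat>"
      using tr by (simp add: tensor_trace_def AH)
  qed
qed

text \<open>
  For Hermitian \<open>D\<close> the trace of \<open>D D\<close> is the squared Frobenius norm. Take \<open>D = P - Q\<close>, where the
  hypotheses give \<open>P Q = Q P = Q\<close>.
\<close>

lemma trace_projection_diff:
  assumes P: "conj_transpose N P = P" "P \<star>\<^bsub>N\<^esub> P = P"
    and Q: "conj_transpose N Q = Q" "Q \<star>\<^bsub>N\<^esub> Q = Q"
    and PQ: "P \<star>\<^bsub>N\<^esub> Q = Q"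
  shows "tensor_trace N P - tensor_trace N Q
    = of_real (\<Sum>i\<in>multi_indices N. \<Sum>j\<in>multi_indices N. (cmod (P (i @ j) - Q (i @ j)))\<^sup>2)"
proof -
  let ?I = "multi_indices N"
  have tr: "tensor_trace N (U \<star>\<^bsub>N\<^esub> V) = (\<Sum>i\<in>?I. \<Sum>j\<in>?I. U (i @ j) * V (j @ i))" for U V
    by (simp add: tensor_trace_def einstein_product_entry)
  have QP: "Q \<star>\<^bsub>N\<^esub> P = Q"
    using conj_transpose_product[of N P Q] P Q PQ by simp
  have cnj: "cnj (P (i @ j)) = P (j @ i)" "cnj (Q (i @ j)) = Q (j @ i)" if "i \<in> ?I" "j \<in> ?I" for i j
    using that conj_transpose_entry[of j N i P] conj_transpose_entry[of j N i Q] P Q by simp_all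
  have "of_real (\<Sum>i\<in>?I. \<Sum>j\<in>?I. (cmod (P (i @ j) - Q (i @ j)))\<^sup>2)
      = (\<Sum>i\<in>?I. \<Sum>j\<in>?I. (P (i @ j) - Q (i @ j)) * (P (j @ i) - Q (j @ i)))"
    unfolding of_real_sum by (intro sum.cong refl) (simp only: complex_norm_square complex_cnj_diff cnj)
  also have "\<dots> = tensor_trace N (P \<star>\<^bsub>N\<^esub> P) - tensor_trace N (P \<star>\<^bsub>N\<^esub> Q)
      - (tensor_trace N (Q \<star>\<^bsub>N\<^esub> P) - tensor_trace N (Q \<star>\<^bsub>N\<^esub> Q))"
    unfolding tr by (simp add: algebra_simps sum_subtractf sum.distrib)
  finally show ?thesis
    using P Q PQ QP by simp
qed

lemma projection_eq_if_trace_eq: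
  assumes P: "P \<in> tensors (N @ N)" "conj_transpose N P = P" "P \<star>\<^bsub>N\<^esub> P = P"
    and Q: "Q \<in> tensors (N @ N)" "conj_transpose N Q = Q" "Q \<star>\<^bsub>N\<^esub> Q = Q"
    and PQ: "P \<star>\<^bsub>N\<^esub> Q = Q"
    and tr: "tensor_trace N P = tensor_trace N Q"
  shows "P = Q"
proof (rule tensor_eqI[OF P(1) Q(1)])
  fix i j assume "i \<in> multi_indices N" "j \<in> multi_indices N"
  moreover have "(\<Sum>i\<in>multi_indices N. \<Sum>j\<in>multi_indices N. (cmod (P (i @ j) - Q (i @ j)))\<^sup>2) = 0"
    using trace_projection_diff[OF P(2,3) Q(2,3) PQ, symmetric] unfolding tr diff_self of_real_eq_0_iff .
  ultimately show "P (i @ j) = Q (i @ j)"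
    by (simp add: sum_nonneg_eq_0_iff sum_nonneg finite_multi_indices)
qed

section \<open>The index of a tensor\<close>

text \<open>
  The least number in the definition of the index exists: the projections onto the ranges of the
  powers of \<open>A\<close> have decreasing natural numbers as traces, and two consecutive projections with equal
  traces coincide.
\<close>

lemma ex_tensor_range_power_stable:
  assumes A: "A \<in> tensors (N @ N)"
  shows "\<exists>k>0. tensor_range N (tensor_power N A k) = tensor_range N (tensor_power N A (k + 1))"
proof -
  have "\<exists>H. conj_transpose N (tensor_power N A (Suc k) \<star>\<^bsub>N\<^esub> H) = tensor_power N A (Suc k) \<star>\<^bsub>N\<^esub> H \<and>
      tensor_power N A (Suc k) \<star>\<^bsub>N\<^esub> (H \<star>\<^bsub>N\<^esub> tensor_power N A (Suc k)) = tensor_power N A (Suc k) \<and>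
      tensor_trace N (tensor_power N A (Suc k) \<star>\<^bsub>N\<^esub> H) \<in> \<nat>" for k
    by (rule ex_hermitian_inner_inverse[of "tensor_power N A (Suc k)" N]) auto
  then obtain H where
      herm: "\<And>k. conj_transpose N (tensor_power N A (Suc k) \<star>\<^bsub>N\<^esub> H k) = tensor_power N A (Suc k) \<star>\<^bsub>N\<^esub> H k"
    and inner: "\<And>k. tensor_power N A (Suc k) \<star>\<^bsub>N\<^esub> (H k \<star>\<^bsub>N\<^esub> tensor_power N A (Suc k)) = tensor_power N A (Suc k)"
    and nat_trace: "\<And>k. tensor_trace N (tensor_power N A (Suc k) \<star>\<^bsub>N\<^esub> H k) \<in> \<nat>"
    by metis
  have "\<exists>d. tensor_trace N (tensor_power N A (Suc k) \<star>\<^bsub>N\<^esub> H k) = of_nat d" for k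
    using nat_trace[of k] by (elim Nats_cases) blast
  then obtain d where d: "\<And>k. tensor_trace N (tensor_power N A (Suc k) \<star>\<^bsub>N\<^esub> H k) = of_nat (d k)"
    by (rule that[OF someI_ex])
  \<comment> \<open>The shift by one keeps the exponent positive, as the index requires.\<close>
  define P where "P k = tensor_power N A (Suc k) \<star>\<^bsub>N\<^esub> H k" for k
  have P: "P k \<in> tensors (N @ N)" "conj_transpose N (P k) = P k" for k
    by (simp_all only: P_def herm einstein_product_in_tensors)
  have fix_power: "P k \<star>\<^bsub>N\<^esub> tensor_power N A (Suc k) = tensor_power N A (Suc k)" for k
    unfolding P_def einstein_product_assoc by (rule inner)
  have idem: "P k \<star>\<^bsub>N\<^esub> P k = P k" for k
    by (subst (2 3) P_def) (simp only: fix_power flip: einstein_product_assoc)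
  have nested: "P k \<star>\<^bsub>N\<^esub> P (Suc k) = P (Suc k)" for k
    by (simp only: P_def[of "Suc k"] tensor_power.simps(2)[of _ _ "Suc k"] fix_power
        flip: einstein_product_assoc)
  obtain k where k: "\<And>l. d k \<le> d l"
    using ex_has_least_nat[of "\<lambda>_. True" 0 d] by auto
  have "0 \<le> (\<Sum>i\<in>multi_indices N. \<Sum>j\<in>multi_indices N. (cmod (P k (i @ j) - P (Suc k) (i @ j)))\<^sup>2)"
    by (intro sum_nonneg) simp
  moreover have "complex_of_real (real (d k) - real (d (Suc k))) = of_real
      (\<Sum>i\<in>multi_indices N. \<Sum>j\<in>multi_indices N. (cmod (P k (i @ j) - P (Suc k) (i @ j)))\<^sup>2)"
    using trace_projection_diff[OF P(2) idem P(2) idem nested, of k] d by (simp add: P_def del: tensor_power.simps)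
  ultimately have "d (Suc k) \<le> d k"
    unfolding of_real_eq_iff by linarith
  then have "d k = d (Suc k)"
    using k by (simp add: order.antisym)
  then have "tensor_trace N (P k) = tensor_trace N (P (Suc k))"
    unfolding P_def d by simp
  then have "P k = P (Suc k)"
    using P idem nested projection_eq_if_trace_eq by metis
  then have "tensor_power N A (Suc k)
      = tensor_power N A (Suc (Suc k)) \<star>\<^bsub>N\<^esub> (H (Suc k) \<star>\<^bsub>N\<^esub> tensor_power N A (Suc k))"
    using fix_power[of k] by (simp only: P_def[of "Suc k"] einstein_product_assoc)
  moreover have "tensor_power N A (Suc m) \<in> tensors (N @ N)" for m
    by simp
  ultimately have "tensor_range N (tensor_power N A (Suc k)) \<subseteq> tensor_range N (tensor_power N A (Suc (Suc k)))"
    using tensor_range_subset_iff einstein_product_in_tensors by metis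
  moreover have "tensor_range N (tensor_power N A (Suc (Suc k))) \<subseteq> tensor_range N (tensor_power N A (Suc k))"
    using tensor_range_subset_iff[of "tensor_power N A (Suc (Suc k))" N] A by (simp only: tensor_power.simps einstein_product_in_tensors) blast
  ultimately have "tensor_range N (tensor_power N A (Suc k)) = tensor_range N (tensor_power N A (Suc k + 1))"
    by simp
  then show ?thesis
    by blast
qed

lemma core_tensor_factorization:
  assumes "core_tensor N A"
  obtains T where "T \<in> tensors (N @ N)" "A = A \<star>\<^bsub>N\<^esub> A \<star>\<^bsub>N\<^esub> T"
proof -
  have A: "A \<in> tensors (N @ N)" and idx: "tensor_index N A = 1"
    using assms by (auto simp: core_tensor_def)
  have "tensor_range N (tensor_power N A (tensor_index N A))
      = tensor_range N (tensor_power N A (tensor_index N A + 1))"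
    using LeastI_ex[OF ex_tensor_range_power_stable[OF A]] unfolding tensor_index_def by blast
  then have "tensor_range N A = tensor_range N (A \<star>\<^bsub>N\<^esub> A)"
    by (simp add: idx identity_tensor_left A)
  then show ?thesis
    using that tensor_range_subset_iff[OF A] by blast
qed

section \<open>Core and Moore-Penrose inverses\<close>

lemma is_core_inverse_iff:
  assumes "A \<in> tensors (N @ N)"
  shows "is_core_inverse N A X \<longleftrightarrow> X \<in> tensors (N @ N) \<and>
    conj_transpose N (A \<star>\<^bsub>N\<^esub> X) = A \<star>\<^bsub>N\<^esub> X \<and>
    X \<star>\<^bsub>N\<^esub> (A \<star>\<^bsub>N\<^esub> A) = A \<and> A \<star>\<^bsub>N\<^esub> (X \<star>\<^bsub>N\<^esub> X) = X"
  unfolding is_core_inverse_def using assms by (auto simp: tensor_power_2)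

lemma core_inverse_inner:
  assumes "A \<in> tensors (N @ N)" "is_core_inverse N A X"
  shows "A \<star>\<^bsub>N\<^esub> (X \<star>\<^bsub>N\<^esub> A) = A"
  using assms unfolding is_core_inverse_iff[OF assms(1)] by (metis einstein_product_assoc)

lemma core_inverse_outer:
  assumes "A \<in> tensors (N @ N)" "is_core_inverse N A X"
  shows "X \<star>\<^bsub>N\<^esub> (A \<star>\<^bsub>N\<^esub> X) = X"
  using assms unfolding is_core_inverse_iff[OF assms(1)] by (metis einstein_product_assoc)

text \<open>Both products are the orthogonal projection onto the range of \<open>A\<close>.\<close>

lemma hermitian_inner_inverse_product_unique:
  assumes "conj_transpose N (A \<star>\<^bsub>N\<^esub> X) = A \<star>\<^bsub>N\<^esub> X" "A \<star>\<^bsub>N\<^esub> (X \<star>\<^bsub>N\<^esub> A) = A"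
    and "conj_transpose N (A \<star>\<^bsub>N\<^esub> Y) = A \<star>\<^bsub>N\<^esub> Y" "A \<star>\<^bsub>N\<^esub> (Y \<star>\<^bsub>N\<^esub> A) = A"
  shows "A \<star>\<^bsub>N\<^esub> X = A \<star>\<^bsub>N\<^esub> Y"
proof -
  have "A \<star>\<^bsub>N\<^esub> X \<star>\<^bsub>N\<^esub> (A \<star>\<^bsub>N\<^esub> Y) = A \<star>\<^bsub>N\<^esub> Y" "A \<star>\<^bsub>N\<^esub> Y \<star>\<^bsub>N\<^esub> (A \<star>\<^bsub>N\<^esub> X) = A \<star>\<^bsub>N\<^esub> X"
    using assms by (metis einstein_product_assoc)+
  then show ?thesis
    using conj_transpose_product assms by metis
qed

lemma core_inverse_unique:
  assumes A: "A \<in> tensors (N @ N)" and X: "is_core_inverse N A X" and Y: "is_core_inverse N A Y"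
  shows "X = Y"
proof -
  note X' = X[unfolded is_core_inverse_iff[OF A]] and Y' = Y[unfolded is_core_inverse_iff[OF A]]
  have eq: "A \<star>\<^bsub>N\<^esub> X = A \<star>\<^bsub>N\<^esub> Y"
    by (rule hermitian_inner_inverse_product_unique)
      (use X' Y' A X Y core_inverse_inner in auto)
  have "X = X \<star>\<^bsub>N\<^esub> (A \<star>\<^bsub>N\<^esub> Y)"
    using core_inverse_outer[OF A X] eq by simp
  also have "\<dots> = X \<star>\<^bsub>N\<^esub> (A \<star>\<^bsub>N\<^esub> A) \<star>\<^bsub>N\<^esub> (Y \<star>\<^bsub>N\<^esub> Y)"
    using Y' by (simp add: einstein_product_assoc)
  also have "\<dots> = Y"
    using X' Y' by simp
  finally show ?thesis .
qed

lemma core_inverse_eqI: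
  assumes "A \<in> tensors (N @ N)" "is_core_inverse N A X"
  shows "core_inverse N A = X"
  unfolding core_inverse_def using assms core_inverse_unique by blast

lemma is_core_inverse_core_inverse:
  assumes "A \<in> tensors (N @ N)" "core_invertible N A"
  shows "is_core_inverse N A (core_inverse N A)"
  using assms core_inverse_eqI unfolding core_invertible_def by metis

text \<open>
  With \<open>A = A A T\<close> and the projection \<open>P = A H\<close> onto the range of \<open>A\<close>, the tensor \<open>X = A T H P\<close> is a
  right inverse of \<open>A\<close> on this range: \<open>A X = P\<close>. It is also a left inverse there because the
  idempotent \<open>F = X A P\<close> has its range inside that of \<open>P\<close> and the same trace as \<open>P\<close>.
\<close>

lemma core_tensor_core_invertible:
  assumes "core_tensor N A"
  shows "core_invertible N A"
proof -
  have A: "A \<in> tensors (N @ N)"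
    using assms by (simp add: core_tensor_def)
  obtain T where T: "A = A \<star>\<^bsub>N\<^esub> A \<star>\<^bsub>N\<^esub> T"
    using core_tensor_factorization[OF assms] by blast
  obtain H where H: "conj_transpose N (A \<star>\<^bsub>N\<^esub> H) = A \<star>\<^bsub>N\<^esub> H" "A \<star>\<^bsub>N\<^esub> (H \<star>\<^bsub>N\<^esub> A) = A"
    using ex_hermitian_inner_inverse[OF A] by metis
  define P where "P = A \<star>\<^bsub>N\<^esub> H"
  have PA: "P \<star>\<^bsub>N\<^esub> A = A" and P_herm: "conj_transpose N P = P" and P_tens: "P \<in> tensors (N @ N)"
    using H by (simp_all add: P_def einstein_product_assoc)
  have PP: "P \<star>\<^bsub>N\<^esub> P = P"
    using PA unfolding P_def by (metis einstein_product_assoc)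
  define X where "X = A \<star>\<^bsub>N\<^esub> T \<star>\<^bsub>N\<^esub> H \<star>\<^bsub>N\<^esub> P"
  have AX: "A \<star>\<^bsub>N\<^esub> X = P"
    using T PP unfolding X_def P_def by (metis einstein_product_assoc)
  have PX: "P \<star>\<^bsub>N\<^esub> X = X" and XP: "X \<star>\<^bsub>N\<^esub> P = X"
    using PA PP unfolding X_def by (metis einstein_product_assoc)+
  define F where "F = X \<star>\<^bsub>N\<^esub> A \<star>\<^bsub>N\<^esub> P"
  have F_tens: "F \<in> tensors (N @ N)"
    by (simp add: F_def)
  have PF: "P \<star>\<^bsub>N\<^esub> F = F" and FP: "F \<star>\<^bsub>N\<^esub> P = F" and FF: "F \<star>\<^bsub>N\<^esub> F = F"
    using AX PX PP XP PA unfolding F_def by (metis einstein_product_assoc)+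
  have trF: "tensor_trace N F = tensor_trace N P"
    using tensor_trace_commute[of N X "A \<star>\<^bsub>N\<^esub> P"] AX PX by (simp add: F_def einstein_product_assoc)
  obtain G where G: "conj_transpose N (F \<star>\<^bsub>N\<^esub> G) = F \<star>\<^bsub>N\<^esub> G" "F \<star>\<^bsub>N\<^esub> (G \<star>\<^bsub>N\<^esub> F) = F"
    using ex_hermitian_inner_inverse[OF F_tens] by metis
  \<comment> \<open>\<open>F\<close> need not be Hermitian, so it is compared with \<open>P\<close> through the projection \<open>Q\<close> onto its range.\<close>
  define Q where "Q = F \<star>\<^bsub>N\<^esub> G"
  have QF: "Q \<star>\<^bsub>N\<^esub> F = F" and FQ: "F \<star>\<^bsub>N\<^esub> Q = Q" and QQ: "Q \<star>\<^bsub>N\<^esub> Q = Q" and PQ: "P \<star>\<^bsub>N\<^esub> Q = Q"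
    using G FF PF unfolding Q_def by (metis einstein_product_assoc)+
  have "tensor_trace N P = tensor_trace N Q"
    using tensor_trace_commute[of N Q F] QF FQ trF by simp
  then have "P = Q"
    using projection_eq_if_trace_eq P_tens P_herm PP QQ PQ G(1) Q_def einstein_product_in_tensors
    by metis
  then have "F = P"
    using FQ FP by simp
  then have "X \<star>\<^bsub>N\<^esub> (A \<star>\<^bsub>N\<^esub> A) = A"
    using PA unfolding F_def by (metis einstein_product_assoc)
  moreover have "A \<star>\<^bsub>N\<^esub> (X \<star>\<^bsub>N\<^esub> X) = X"
    using AX PX by (simp flip: einstein_product_assoc)
  ultimately have "is_core_inverse N A X"
    unfolding is_core_inverse_iff[OF A] using AX P_herm X_def by simp
  then show ?thesis
    unfolding core_invertible_def by blast
qed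

text \<open>
  An inner inverse \<open>H\<close> with \<open>A H\<close> Hermitian and an inner inverse \<open>K\<close> with \<open>K A\<close> Hermitian combine to
  the Moore-Penrose inverse \<open>K A H\<close>.
\<close>

lemma ex_moore_penrose_inverse:
  assumes A: "A \<in> tensors (N @ N)"
  shows "\<exists>X. is_moore_penrose_inverse N A X"
proof -
  obtain H where H: "conj_transpose N (A \<star>\<^bsub>N\<^esub> H) = A \<star>\<^bsub>N\<^esub> H" "A \<star>\<^bsub>N\<^esub> (H \<star>\<^bsub>N\<^esub> A) = A"
    using ex_hermitian_inner_inverse[OF A] by metis
  let ?B = "conj_transpose N A"
  obtain G where G: "conj_transpose N (?B \<star>\<^bsub>N\<^esub> G) = ?B \<star>\<^bsub>N\<^esub> G" "?B \<star>\<^bsub>N\<^esub> (G \<star>\<^bsub>N\<^esub> ?B) = ?B"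
    using ex_hermitian_inner_inverse[OF conj_transpose_in_tensors] by metis
  define K where "K = conj_transpose N G"
  have K: "conj_transpose N (K \<star>\<^bsub>N\<^esub> A) = K \<star>\<^bsub>N\<^esub> A" "A \<star>\<^bsub>N\<^esub> (K \<star>\<^bsub>N\<^esub> A) = A"
    using G A unfolding K_def
    by (metis conj_transpose_product conj_transpose_conj_transpose einstein_product_assoc)+
  define X where "X = K \<star>\<^bsub>N\<^esub> (A \<star>\<^bsub>N\<^esub> H)"
  have "A \<star>\<^bsub>N\<^esub> X = A \<star>\<^bsub>N\<^esub> H" "X \<star>\<^bsub>N\<^esub> A = K \<star>\<^bsub>N\<^esub> A"
    using H K unfolding X_def by (metis einstein_product_assoc)+
  moreover from this have "X \<star>\<^bsub>N\<^esub> A \<star>\<^bsub>N\<^esub> X = X"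
    using K unfolding X_def by (metis einstein_product_assoc)
  ultimately have "is_moore_penrose_inverse N A X"
    using H K unfolding is_moore_penrose_inverse_def
    by (simp add: X_def einstein_product_assoc)
  then show ?thesis by blast
qed

lemma moore_penrose_inverse_unique:
  assumes X: "is_moore_penrose_inverse N A X" and Y: "is_moore_penrose_inverse N A Y"
  shows "X = Y"
proof -
  note X' = X[unfolded is_moore_penrose_inverse_def einstein_product_assoc]
    and Y' = Y[unfolded is_moore_penrose_inverse_def einstein_product_assoc]
  have 1: "A \<star>\<^bsub>N\<^esub> X = A \<star>\<^bsub>N\<^esub> Y"
    by (rule hermitian_inner_inverse_product_unique) (use X' Y' in auto)
  have "X \<star>\<^bsub>N\<^esub> A \<star>\<^bsub>N\<^esub> (Y \<star>\<^bsub>N\<^esub> A) = X \<star>\<^bsub>N\<^esub> A" "Y \<star>\<^bsub>N\<^esub> A \<star>\<^bsub>N\<^esub> (X \<star>\<^bsub>N\<^esub> A) = Y \<star>\<^bsub>N\<^esub> A"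
    using X' Y' by (metis einstein_product_assoc)+
  then have 2: "X \<star>\<^bsub>N\<^esub> A = Y \<star>\<^bsub>N\<^esub> A"
    using conj_transpose_product X' Y' by metis
  show ?thesis
    using 1 2 X' Y' by (metis einstein_product_assoc)
qed

text \<open>For an EP tensor the Moore-Penrose inverse is the core inverse.\<close>

lemma EP_core_inverse_commute:
  assumes A: "A \<in> tensors (N @ N)" and EP: "EP_tensor N A"
  shows "A \<star>\<^bsub>N\<^esub> core_inverse N A = core_inverse N A \<star>\<^bsub>N\<^esub> A"
proof -
  let ?D = "moore_penrose_inverse N A"
  have "is_moore_penrose_inverse N A ?D"
    unfolding moore_penrose_inverse_def
    using ex_moore_penrose_inverse[OF A] moore_penrose_inverse_unique by (metis theI)
  note D = this[unfolded is_moore_penrose_inverse_def einstein_product_assoc]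
  have comm: "A \<star>\<^bsub>N\<^esub> ?D = ?D \<star>\<^bsub>N\<^esub> A"
    using EP by (simp add: EP_tensor_def)
  have "is_core_inverse N A ?D"
    unfolding is_core_inverse_iff[OF A] using D comm by (metis einstein_product_assoc)
  then show ?thesis
    using core_inverse_eqI[OF A] comm by simp
qed

section \<open>The reverse order law\<close>

theorem theorem3p11:
  fixes N :: "nat list" and A B :: tensor
  assumes "N \<noteq> []" and "\<forall>d\<in>set N. 1 \<le> d"
    and "A \<in> tensors (N @ N)" and "B \<in> tensors (N @ N)"
    and "core_tensor N A" and "core_tensor N B"
    and "tensor_range N A \<subseteq> tensor_range N (A \<star>\<^bsub>N\<^esub> B)"
    and "EP_tensor N A"
    and "core_invertible N (A \<star>\<^bsub>N\<^esub> B)"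
    and "core_inverse N (A \<star>\<^bsub>N\<^esub> B) = core_inverse N B \<star>\<^bsub>N\<^esub> core_inverse N A"
  shows "core_invertible N (conj_transpose N (core_inverse N A) \<star>\<^bsub>N\<^esub> B) \<and>
    core_inverse N (conj_transpose N (core_inverse N A) \<star>\<^bsub>N\<^esub> B)
      = core_inverse N B \<star>\<^bsub>N\<^esub> conj_transpose N A"
proof -
  note A = assms(3) and B = assms(4)
  define X Y where "X = core_inverse N A" and "Y = core_inverse N B"
  define As Xs where "As = conj_transpose N A" and "Xs = conj_transpose N X"
  define M P where "M = A \<star>\<^bsub>N\<^esub> B" and "P = A \<star>\<^bsub>N\<^esub> X"
  define Z where "Z = Y \<star>\<^bsub>N\<^esub> X"
  have M_tens: "M \<in> tensors (N @ N)"
    by (simp add: M_def)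
  have coreX: "is_core_inverse N A X" and coreY: "is_core_inverse N B Y"
    unfolding X_def Y_def
    using assms is_core_inverse_core_inverse core_tensor_core_invertible by blast+
  have coreZ: "is_core_inverse N M Z"
    using is_core_inverse_core_inverse[OF M_tens] assms(9,10)
    by (simp add: M_def Z_def X_def Y_def)
  note X = coreX[unfolded is_core_inverse_iff[OF A]]
    and Z = coreZ[unfolded is_core_inverse_iff[OF M_tens]]
  have XA: "X \<star>\<^bsub>N\<^esub> A = P"
    using EP_core_inverse_commute[OF A assms(8)] by (simp add: X_def P_def)
  have P_herm: "conj_transpose N P = P"
    using X by (simp add: P_def)
  have PA: "P \<star>\<^bsub>N\<^esub> A = A" and AP: "A \<star>\<^bsub>N\<^esub> P = A"
    using core_inverse_inner[OF A coreX] XA by (simp_all add: P_def einstein_product_assoc)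
  have XP: "X \<star>\<^bsub>N\<^esub> P = X"
    using core_inverse_outer[OF A coreX] by (simp add: P_def)
  have PAs: "P \<star>\<^bsub>N\<^esub> As = As" and PXs: "P \<star>\<^bsub>N\<^esub> Xs = Xs" and AsXs: "As \<star>\<^bsub>N\<^esub> Xs = P"
    using conj_transpose_product[of N A P] conj_transpose_product[of N X P]
      conj_transpose_product[of N X A] AP XP XA P_herm by (simp_all add: As_def Xs_def)
  obtain T where T: "A = M \<star>\<^bsub>N\<^esub> T"
    using assms(7) tensor_range_subset_iff[OF A] unfolding M_def by blast
  have MZ: "M \<star>\<^bsub>N\<^esub> Z = P"
  proof -
    \<comment> \<open>\<open>M Z\<close> and \<open>P\<close> are Hermitian and each fixes the other from the left.\<close>
    have "M \<star>\<^bsub>N\<^esub> Z \<star>\<^bsub>N\<^esub> P = P"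
      using core_inverse_inner[OF M_tens coreZ] T unfolding P_def by (metis einstein_product_assoc)
    moreover have "P \<star>\<^bsub>N\<^esub> (M \<star>\<^bsub>N\<^esub> Z) = M \<star>\<^bsub>N\<^esub> Z"
      using PA unfolding M_def by (metis einstein_product_assoc)
    ultimately show ?thesis
      using conj_transpose_product P_herm Z by metis
  qed
  have PYP: "P \<star>\<^bsub>N\<^esub> (Y \<star>\<^bsub>N\<^esub> P) = Y \<star>\<^bsub>N\<^esub> P"
  proof -
    have "P \<star>\<^bsub>N\<^esub> Z = Z"
      using Z MZ by (metis einstein_product_assoc)
    then show ?thesis
      using XA unfolding Z_def by (metis einstein_product_assoc)
  qed
  have YPBP: "Y \<star>\<^bsub>N\<^esub> (P \<star>\<^bsub>N\<^esub> (B \<star>\<^bsub>N\<^esub> P)) = P"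
  proof -
    have "Y \<star>\<^bsub>N\<^esub> (P \<star>\<^bsub>N\<^esub> (B \<star>\<^bsub>N\<^esub> M)) = M"
      using Z XA unfolding Z_def M_def by (metis einstein_product_assoc)
    then show ?thesis
      using MZ by (metis einstein_product_assoc)
  qed
  define C W where "C = Xs \<star>\<^bsub>N\<^esub> B" and "W = Y \<star>\<^bsub>N\<^esub> As"
  have CW: "C \<star>\<^bsub>N\<^esub> W = P"
  proof -
    have "C \<star>\<^bsub>N\<^esub> W = Xs \<star>\<^bsub>N\<^esub> (conj_transpose N (B \<star>\<^bsub>N\<^esub> Y) \<star>\<^bsub>N\<^esub> As)"
      using coreY[unfolded is_core_inverse_iff[OF B]] by (simp add: C_def W_def einstein_product_assoc)
    also have "\<dots> = conj_transpose N (M \<star>\<^bsub>N\<^esub> Z)"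
      by (simp add: M_def Z_def As_def Xs_def conj_transpose_product einstein_product_assoc)
    finally show ?thesis
      using MZ P_herm by simp
  qed
  have "C \<star>\<^bsub>N\<^esub> (W \<star>\<^bsub>N\<^esub> W) = W"
    using CW PYP PAs unfolding W_def by (metis einstein_product_assoc)
  moreover have "W \<star>\<^bsub>N\<^esub> (C \<star>\<^bsub>N\<^esub> C) = C"
  proof -
    have "W \<star>\<^bsub>N\<^esub> (C \<star>\<^bsub>N\<^esub> C) = Y \<star>\<^bsub>N\<^esub> (P \<star>\<^bsub>N\<^esub> (B \<star>\<^bsub>N\<^esub> (P \<star>\<^bsub>N\<^esub> (Xs \<star>\<^bsub>N\<^esub> B))))"
      using einstein_product_extend[OF AsXs] einstein_product_extend[OF PXs]
      by (simp add: W_def C_def einstein_product_assoc)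
    also have "\<dots> = P \<star>\<^bsub>N\<^esub> (Xs \<star>\<^bsub>N\<^esub> B)"
      using YPBP by (metis einstein_product_assoc)
    finally show ?thesis
      using einstein_product_extend[OF PXs] by (simp add: C_def)
  qed
  moreover have "C \<in> tensors (N @ N)" "W \<in> tensors (N @ N)"
    by (simp_all add: C_def W_def)
  ultimately have "is_core_inverse N C W" "C \<in> tensors (N @ N)"
    using is_core_inverse_iff CW P_herm by metis+
  then show ?thesis
    using core_inverse_eqI unfolding core_invertible_def
    by (metis C_def W_def Xs_def As_def X_def Y_def)
qed

end
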